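(* Let $n\ge1$ and $m\ge 1$ be integers, let $G$ be a simple acyclic directed graph on the vertex set $[n]=\{1,\dots,n\}$, and let $h$ be the length of the longest path in $G$. Then the largest elementary divisor of $A_{\vec m,G}$ is at most $m^{h+1}$.
   Context: For a simple acyclic directed graph $G$ on $[n]$ and an integer $m$, let $\vec m=(m,m,\dots,m)$ (length $n$) and let $A_{\vec m,G}=mI_n+\sum_{(i,j)\in E(G)}E_{i,j}$, an $n\times n$ integer matrix, where $(i,j)$ denotes an edge directed from $i$ to $j$ and $E_{i,j}$ is the matrix whose only nonzero entry is a $1$ in row $i$, column $j$. A path in $G$ is a sequence of vertices $v_1\to v_2\to\dots\to v_k$ with $(v_i,v_{i+1})\in E(G)$ for $1\le i\le k-1$; its length is the number $k-1$ of edges (so the longest path has length $0$ if $G$ has no edges). The elementary divisors of a nonsingular $n\times n$ integer matrix $A$ are the positive integers $\alpha_1\mid\alpha_2\mid\dots\mid\alpha_n$ such that $\operatorname{diag}(\alpha_1,\dots,\alpha_n)$ is the Smith normal form of $A$ (entries equal to $1$ included); the largest elementary divisor is $\alpha_n$. *)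

theory Defs
  imports "Jordan_Normal_Form.Matrix"
begin

text \<open>A simple directed graph on [n] = {1, ..., n} is given by its set of edges; \<open>(i, j)\<close> is the
  edge directed from \<open>i\<close> to \<open>j\<close>. Loops are not excluded separately, since acyclicity excludes them.\<close>

definition acyclic_digraph_on :: "nat \<Rightarrow> (nat \<times> nat) set \<Rightarrow> bool" where
  "acyclic_digraph_on n E \<longleftrightarrow> E \<subseteq> {1..n} \<times> {1..n} \<and> acyclic E"

definition digraph_path :: "nat \<Rightarrow> (nat \<times> nat) set \<Rightarrow> nat list \<Rightarrow> bool" where
  "digraph_path n E vs \<longleftrightarrow>
     vs \<noteq> [] \<and> set vs \<subseteq> {1..n} \<and> (\<forall>i. Suc i < length vs \<longrightarrow> (vs ! i, vs ! Suc i) \<in> E)"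

text \<open>The length of a path is its number of edges. For \<open>n \<ge> 1\<close> and an acyclic graph the set of lengths
  is finite (paths do not repeat vertices) and contains 0, so the maximum is meaningful.\<close>

definition longest_path_length :: "nat \<Rightarrow> (nat \<times> nat) set \<Rightarrow> nat" where
  "longest_path_length n E = Max {length vs - 1 | vs. digraph_path n E vs}"

text \<open>The matrix with \<open>m\<close> on the diagonal plus the sum of all \<open>E\<^sub>i\<^sub>j\<close> over the edges \<open>(i, j)\<close>.
  Matrix indices start at 0, so the row and column of vertex \<open>i\<close> have index \<open>i - 1\<close>.\<close>

definition graph_mat :: "nat \<Rightarrow> int \<Rightarrow> (nat \<times> nat) set \<Rightarrow> int mat" where
  "graph_mat n m E =
     m \<cdot>\<^sub>m 1\<^sub>m n + mat n n (\<lambda>(i, j). if (Suc i, Suc j) \<in> E then 1 else 0)"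

text \<open>The list of elementary divisors \<open>\<alpha>\<^sub>1 dvd \<dots> dvd \<alpha>\<^sub>n\<close> of a nonsingular square integer matrix: the
  diagonal of its Smith normal form, entries equal to 1 included. Invertibility of \<open>P\<close> and \<open>Q\<close> is
  over the integers; positivity of the entries normalises their signs.\<close>

definition elementary_divisors :: "int mat \<Rightarrow> int list \<Rightarrow> bool" where
  "elementary_divisors A \<alpha>s \<longleftrightarrow>
     (let n = dim_row A in
      A \<in> carrier_mat n n \<and> length \<alpha>s = n \<and> (\<forall>a \<in> set \<alpha>s. a > 0) \<and>
      (\<forall>i. Suc i < n \<longrightarrow> \<alpha>s ! i dvd \<alpha>s ! Suc i) \<and>
      (\<exists>P Q. P \<in> carrier_mat n n \<and> Q \<in> carrier_mat n n \<and> invertible_mat P \<and> invertible_mat Q \<and>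
             P * A * Q = mat_diag n (\<lambda>i. \<alpha>s ! i)))"

end

theory Submission
  imports Defs
begin

text \<open>Write \<open>A = m I - M\<close>, where \<open>- M\<close> is the adjacency matrix of \<open>G\<close>. A nonzero entry of \<open>M\<^sup>k\<close>
  forces a path with \<open>k\<close> edges, so \<open>M\<^sup>h\<^sup>+\<^sup>1 = 0\<close>, and the geometric sum gives an integer matrix \<open>B\<close>
  with \<open>B A = m\<^sup>h\<^sup>+\<^sup>1 I\<close>. If \<open>P A Q = D\<close> is the Smith normal form, then
  \<open>(Q\<^sup>-\<^sup>1 B P\<^sup>-\<^sup>1) D = m\<^sup>h\<^sup>+\<^sup>1 I\<close>, so every diagonal entry of \<open>D\<close> divides \<open>m\<^sup>h\<^sup>+\<^sup>1\<close>.\<close>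

text \<open>The scalar matrix commutes with \<open>M\<close>, so \<open>m^k I - M^k\<close> factors
  as for commuting ring elements. The cofactor is a polynomial in \<open>M\<close> with no division,
  so for an integer matrix \<open>B\<close> is integral as well.\<close>

lemma geometric_sum_mat:
  fixes M :: "'a :: comm_ring_1 mat"
  assumes M: "M \<in> carrier_mat n n"
  shows "\<exists>B \<in> carrier_mat n n. B * (m \<cdot>\<^sub>m 1\<^sub>m n - M) = m ^ k \<cdot>\<^sub>m 1\<^sub>m n - M ^\<^sub>m k"
proof (induction k)
  case 0
  have "0\<^sub>m n n * (m \<cdot>\<^sub>m 1\<^sub>m n - M) = m ^ 0 \<cdot>\<^sub>m 1\<^sub>m n - M ^\<^sub>m 0"
    using M by (intro eq_matI) (auto simp: scalar_prod_def)
  then show ?case by (meson zero_carrier_mat)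
next
  case (Suc k)
  then obtain B where B: "B \<in> carrier_mat n n"
    and eq: "B * (m \<cdot>\<^sub>m 1\<^sub>m n - M) = m ^ k \<cdot>\<^sub>m 1\<^sub>m n - M ^\<^sub>m k" by blast
  have Mk: "M ^\<^sub>m k \<in> carrier_mat n n" using M by simp
  have A: "m \<cdot>\<^sub>m 1\<^sub>m n - M \<in> carrier_mat n n" using M by (simp add: minus_carrier_mat)
  \<comment> \<open>The cofactors obey the recursion \<open>B' = m B + M^k\<close>. After expansion
    the two terms \<open>m M^k\<close> cancel.\<close>
  have "(m \<cdot>\<^sub>m B + M ^\<^sub>m k) * (m \<cdot>\<^sub>m 1\<^sub>m n - M)
      = m \<cdot>\<^sub>m (B * (m \<cdot>\<^sub>m 1\<^sub>m n - M)) + M ^\<^sub>m k * (m \<cdot>\<^sub>m 1\<^sub>m n - M)"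
    using B A Mk by (simp add: add_mult_distrib_mat[of _ n n] mult_smult_assoc_mat[of _ n n])
  also have "M ^\<^sub>m k * (m \<cdot>\<^sub>m 1\<^sub>m n - M) = m \<cdot>\<^sub>m M ^\<^sub>m k - M ^\<^sub>m k * M"
    using Mk M
    by (simp add: mult_minus_distrib_mat[OF Mk smult_carrier_mat[OF one_carrier_mat] M]
        mult_smult_distrib[OF Mk one_carrier_mat])
  also have "m \<cdot>\<^sub>m (B * (m \<cdot>\<^sub>m 1\<^sub>m n - M)) + (m \<cdot>\<^sub>m M ^\<^sub>m k - M ^\<^sub>m k * M)
      = m ^ Suc k \<cdot>\<^sub>m 1\<^sub>m n - M ^\<^sub>m Suc k"
    unfolding eq using Mk M
    by (intro eq_matI) (auto simp: algebra_simps)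
  finally have "(m \<cdot>\<^sub>m B + M ^\<^sub>m k) * (m \<cdot>\<^sub>m 1\<^sub>m n - M) = m ^ Suc k \<cdot>\<^sub>m 1\<^sub>m n - M ^\<^sub>m Suc k" .
  moreover have "m \<cdot>\<^sub>m B + M ^\<^sub>m k \<in> carrier_mat n n" using B Mk by simp
  ultimately show ?case by blast
qed

lemma digraph_path_append:
  assumes "digraph_path n E vs" "v \<in> {1..n}" "(last vs, v) \<in> E"
  shows "digraph_path n E (vs @ [v])"
proof -
  have "((vs @ [v]) ! i, (vs @ [v]) ! Suc i) \<in> E" if i: "Suc i < length (vs @ [v])" for i
  proof (cases "Suc i = length vs")
    case True
    then have "vs ! i = last vs" by (metis diff_Suc_1 last_conv_nth length_0_conv nat.distinct(1))
    with True assms(3) show ?thesis by (simp add: nth_append)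
  next
    case False
    with i assms(1) show ?thesis by (auto simp: nth_append digraph_path_def)
  qed
  then show ?thesis using assms(1,2) by (simp add: digraph_path_def)
qed

text \<open>Induction on \<open>k\<close>, splitting off the last factor \<open>M\<close> as the
  last edge of the path. The endpoint \<open>Suc j\<close> is recorded so that this edge can be
  attached; \<open>Suc\<close> turns a matrix index into a vertex.\<close>

lemma pow_mat_nonzero_imp_path:
  fixes M :: "'a :: semiring_1 mat"
  assumes M: "M \<in> carrier_mat n n"
    and supp: "\<And>i j. i < n \<Longrightarrow> j < n \<Longrightarrow> M $$ (i, j) \<noteq> 0 \<Longrightarrow> (Suc i, Suc j) \<in> E"
    and "i < n" "j < n" "(M ^\<^sub>m k) $$ (i, j) \<noteq> 0"
  shows "\<exists>vs. digraph_path n E vs \<and> length vs = Suc k \<and> last vs = Suc j"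
  using assms(4,5)
proof (induction k arbitrary: j)
  case 0
  \<comment> \<open>\<open>M^0\<close> is the identity, so any one-vertex path serves, here the one
    at \<open>Suc j\<close>.\<close>
  then show ?case
    by (intro exI[of _ "[Suc j]"]) (auto simp: digraph_path_def)
next
  case (Suc k)
  have Mk: "M ^\<^sub>m k \<in> carrier_mat n n" using M by simp
  have "(M ^\<^sub>m Suc k) $$ (i, j) = (\<Sum>l<n. (M ^\<^sub>m k) $$ (i, l) * M $$ (l, j))"
    using M Mk Suc.prems \<open>i < n\<close> by (auto simp: scalar_prod_def atLeast0LessThan intro!: sum.cong)
  with Suc.prems have "(\<Sum>l<n. (M ^\<^sub>m k) $$ (i, l) * M $$ (l, j)) \<noteq> 0" by simp
  \<comment> \<open>Some summand is nonzero, whatever cancellation occurs among the others.\<close>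
  then obtain l where l: "l < n" "(M ^\<^sub>m k) $$ (i, l) * M $$ (l, j) \<noteq> 0"
    by (rule sum.not_neutral_contains_not_neutral) simp
  then have "(M ^\<^sub>m k) $$ (i, l) \<noteq> 0" "M $$ (l, j) \<noteq> 0" by auto
  with Suc.IH l obtain vs where "digraph_path n E vs" "length vs = Suc k" "last vs = Suc l"
    by blast
  moreover have "(Suc l, Suc j) \<in> E"
    using supp l Suc.prems \<open>M $$ (l, j) \<noteq> 0\<close> by blast
  ultimately show ?case
    using Suc.prems by (intro exI[of _ "vs @ [Suc j]"]) (auto intro!: digraph_path_append)
qed

lemma digraph_path_trancl:
  assumes "digraph_path n E vs" "i < j" "j < length vs"
  shows "(vs ! i, vs ! j) \<in> E\<^sup>+"
  using assms(2,3)
proof (induction j)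
  case (Suc j)
  then have "(vs ! j, vs ! Suc j) \<in> E"
    using assms(1) by (auto simp: digraph_path_def)
  then show ?case
    using Suc by (cases "i = j") (auto intro: trancl_into_trancl)
qed simp

text \<open>A vertex occurring twice would reach itself in the transitive closure, contradicting
  acyclicity; hence the vertices of a path are distinct elements of \<open>{1..n}\<close>.\<close>

lemma digraph_path_length_le:
  assumes "acyclic E" "digraph_path n E vs"
  shows "length vs \<le> n"
proof -
  have "distinct vs"
    unfolding distinct_conv_nth
    using digraph_path_trancl[OF assms(2)] assms(1)
    by (metis acyclic_def linorder_neqE_nat)
  then have "length vs = card (set vs)" by (simp add: distinct_card)
  also have "\<dots> \<le> card {1..n}"
    using assms(2) by (intro card_mono) (auto simp: digraph_path_def)
  finally show ?thesis by simp
qed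

text \<open>\<open>Max\<close> bounds the members of a finite set only; finiteness comes from the
  bound \<open>n\<close> on the number of vertices of a path.\<close>

lemma length_le_longest_path_length:
  assumes "acyclic E" "digraph_path n E vs"
  shows "length vs \<le> Suc (longest_path_length n E)"
proof -
  have "{length vs - 1 | vs. digraph_path n E vs} \<subseteq> {..n}"
    using digraph_path_length_le[OF assms(1)] by fastforce
  then have "finite {length vs - 1 | vs. digraph_path n E vs}"
    using finite_subset by blast
  then have "length vs - 1 \<le> longest_path_length n E"
    unfolding longest_path_length_def using assms(2) by (intro Max_ge) auto
  then show ?thesis by simp
qed

lemma invertible_mat_obtain_inverse:
  assumes "P \<in> carrier_mat n n" "invertible_mat P"
  obtains P' where "P' \<in> carrier_mat n n" "P * P' = 1\<^sub>m n" "P' * P = 1\<^sub>m n"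
proof -
  obtain P' where P': "P * P' = 1\<^sub>m n" "P' * P = 1\<^sub>m (dim_row P')"
    using assms unfolding invertible_mat_def inverts_mat_def by auto
  \<comment> \<open>Comparing column counts in the two identities fixes both dimensions of
    \<open>P'\<close>.\<close>
  have "dim_col P' = n" using arg_cong[OF P'(1), of dim_col] by simp
  moreover have "dim_row P' = n" using arg_cong[OF P'(2), of dim_col] assms(1) by simp
  ultimately show thesis using P' that by auto
qed

lemma elementary_divisor_dvd:
  assumes A: "A \<in> carrier_mat n n" and ed: "elementary_divisors A \<alpha>s"
    and B: "B \<in> carrier_mat n n" and BA: "B * A = c \<cdot>\<^sub>m 1\<^sub>m n" and i: "i < n"
  shows "\<alpha>s ! i dvd c"
proof -
  obtain P Q where P: "P \<in> carrier_mat n n" "invertible_mat P"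
    and Q: "Q \<in> carrier_mat n n" "invertible_mat Q"
    and D: "P * A * Q = mat_diag n (\<lambda>i. \<alpha>s ! i)"
    using ed A unfolding elementary_divisors_def Let_def by auto
  obtain P' where P': "P' \<in> carrier_mat n n" "P' * P = 1\<^sub>m n"
    using invertible_mat_obtain_inverse[OF P] by blast
  obtain Q' where Q': "Q' \<in> carrier_mat n n" "Q' * Q = 1\<^sub>m n"
    using invertible_mat_obtain_inverse[OF Q] by blast
  \<comment> \<open>\<open>?X\<close> is an integral left inverse of the Smith form up to the factor
    \<open>c\<close>: \<open>P'\<close> cancels \<open>P\<close>, then \<open>B A\<close> becomes
    the scalar \<open>c\<close>, then \<open>Q'\<close> cancels \<open>Q\<close>.\<close>
  let ?X = "Q' * B * P'"
  have X: "?X \<in> carrier_mat n n" using Q' B P' by simp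
  have "?X * (P * A * Q) = Q' * (B * ((P' * P) * (A * Q)))"
    using P(1) Q(1) P'(1) Q'(1) A B by (simp add: assoc_mult_mat[of _ n n _ n _ n])
  also have "\<dots> = Q' * ((B * A) * Q)"
    using P'(2) Q(1) A B by (simp add: assoc_mult_mat[of _ n n _ n _ n])
  also have "\<dots> = c \<cdot>\<^sub>m 1\<^sub>m n"
    unfolding BA using Q(1) Q'
    by (simp add: mult_smult_assoc_mat[of _ n n] mult_smult_distrib[of _ n n])
  finally have "?X * mat_diag n (\<lambda>i. \<alpha>s ! i) = c \<cdot>\<^sub>m 1\<^sub>m n" unfolding D .
  then have "(?X * mat_diag n (\<lambda>i. \<alpha>s ! i)) $$ (i, i) = c" using i by simp
  then have "?X $$ (i, i) * \<alpha>s ! i = c"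
    using i X by (simp add: mat_diag_mult_right[OF X])
  then show ?thesis by auto
qed

theorem theorem4p4:
  fixes n :: nat and m :: int and E :: "(nat \<times> nat) set" and \<alpha>s :: "int list"
  assumes "n \<ge> 1" and "m \<ge> 1"
    and "acyclic_digraph_on n E"
    and "elementary_divisors (graph_mat n m E) \<alpha>s"
  shows "last \<alpha>s \<le> m ^ (longest_path_length n E + 1)"
proof -
  define h where "h = longest_path_length n E"
  \<comment> \<open>The entries are \<open>-1\<close> so that the graph matrix takes the form
    \<open>m I - M\<close> of the geometric sum.\<close>
  define M :: "int mat" where "M = mat n n (\<lambda>(i, j). if (Suc i, Suc j) \<in> E then -1 else 0)"
  have M: "M \<in> carrier_mat n n" by (simp add: M_def)
  have A: "graph_mat n m E = m \<cdot>\<^sub>m 1\<^sub>m n - M"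
    by (intro eq_matI) (auto simp: graph_mat_def M_def)
  have "acyclic E" using assms(3) by (simp add: acyclic_digraph_on_def)
  have "(M ^\<^sub>m Suc h) $$ (i, j) = 0" if ij: "i < n" "j < n" for i j
  proof (rule ccontr)
    assume "(M ^\<^sub>m Suc h) $$ (i, j) \<noteq> 0"
    moreover have "(Suc a, Suc b) \<in> E" if "a < n" "b < n" "M $$ (a, b) \<noteq> 0" for a b
      using that by (simp add: M_def split: if_splits)
    ultimately obtain vs where "digraph_path n E vs" "length vs = Suc (Suc h)"
      using pow_mat_nonzero_imp_path[OF M _ ij] by blast
    \<comment> \<open>A path with \<open>h + 2\<close> vertices has \<open>h + 1\<close> edges, one
      more than the longest path.\<close>
    then show False
      using length_le_longest_path_length[OF \<open>acyclic E\<close>] by (fastforce simp: h_def)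
  qed
  then have "M ^\<^sub>m Suc h = 0\<^sub>m n n"
    using pow_carrier_mat[OF M, of "Suc h"] by (intro eq_matI) auto
  moreover have "m ^ Suc h \<cdot>\<^sub>m 1\<^sub>m n - 0\<^sub>m n n = m ^ Suc h \<cdot>\<^sub>m 1\<^sub>m n"
    by (intro eq_matI) auto
  ultimately obtain B where B: "B \<in> carrier_mat n n" "B * graph_mat n m E = m ^ Suc h \<cdot>\<^sub>m 1\<^sub>m n"
    using geometric_sum_mat[OF M, of m "Suc h"] unfolding A by metis
  have carr: "graph_mat n m E \<in> carrier_mat n n" unfolding A using M by (simp add: minus_carrier_mat)
  have "length \<alpha>s = n"
    using assms(4) carr by (simp add: elementary_divisors_def Let_def)
  then have "last \<alpha>s = \<alpha>s ! (n - 1)"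
    using assms(1) by (subst last_conv_nth) auto
  then have "last \<alpha>s dvd m ^ Suc h"
    using elementary_divisor_dvd[OF carr assms(4) B, of "n - 1"] assms(1) by simp
  \<comment> \<open>A divisor of a positive integer is at most that integer;
    \<open>m \<ge> 1\<close> makes the power positive.\<close>
  then show ?thesis
    using assms(2) by (intro zdvd_imp_le) (auto simp: h_def)
qed

end
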